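(* Let $\mathbb{Z}_{n}$ be the cyclic group of order $n\geq 3$. Then $\frac{n}{n-1}$ is a normalized Laplacian eigenvalue of the power graph $\mathcal{P}(\mathbb{Z}_{n})$ with multiplicity at least $\phi(n)$.
   Context: The power graph $\mathcal{P}(\mathcal{G})$ of a finite group $\mathcal{G}$ has vertex set $\mathcal{G}$, with distinct $x,y$ adjacent iff one is a positive power of the other (in the additive group $\mathbb{Z}_n$: $y=ix$ or $x=jy$ for some positive integers $i,j$). The normalized Laplacian matrix of a graph with no isolated vertices is $I-D^{-1/2}AD^{-1/2}$, $A$ the adjacency matrix and $D$ the diagonal degree matrix. $\phi$ is Euler's totient function. *)

theory Defs
  imports
    "HOL-Algebra.Elementary_Groups"
    "HOL-Number_Theory.Totient"
    "Graph_Theory.Pair_Digraph"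
    "Jordan_Normal_Form.Char_Poly"
begin

definition power_graph :: "('a, 'b) monoid_scheme \<Rightarrow> 'a pair_pre_digraph" where
  "power_graph G = \<lparr>pverts = carrier G,
     parcs = {(x, y). x \<in> carrier G \<and> y \<in> carrier G \<and> x \<noteq> y \<and>
       ((\<exists>i::nat. i > 0 \<and> y = x [^]\<^bsub>G\<^esub> i) \<or> (\<exists>j::nat. j > 0 \<and> x = y [^]\<^bsub>G\<^esub> j))}\<rparr>"

lemma pair_graph_power_graph:
  assumes "finite (carrier G)"
  shows "pair_graph (power_graph G)"
proof
  show "finite (parcs (power_graph G))"
    by (rule finite_subset[of _ "carrier G \<times> carrier G"])
      (use assms in \<open>auto simp: power_graph_def\<close>)
  show "symmetric (with_proj (power_graph G))"
    by (auto simp: symmetric_def power_graph_def intro!: symI)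
qed (use assms in \<open>auto simp: power_graph_def\<close>)

text \<open>
  A graph is a symmetric digraph, each edge being a pair of opposite arcs, so the degree of a
  vertex is its out-degree. A list \<open>vs\<close> enumerating the vertices without repetition assigns rows
  and columns to them.
\<close>

definition adjacency_matrix :: "'a pair_pre_digraph \<Rightarrow> 'a list \<Rightarrow> real mat" where
  "adjacency_matrix \<Gamma> vs =
     mat (length vs) (length vs) (\<lambda>(i, j). if (vs ! i, vs ! j) \<in> parcs \<Gamma> then 1 else 0)"

text \<open>
  The diagonal matrix \<open>D\<^sup>-\<^sup>1\<^sup>/\<^sup>2\<close>, meaningful for graphs without isolated vertices only.
\<close>

definition inv_sqrt_degree_matrix :: "'a pair_pre_digraph \<Rightarrow> 'a list \<Rightarrow> real mat" where
  "inv_sqrt_degree_matrix \<Gamma> vs =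
     mat_diag (length vs) (\<lambda>i. 1 / sqrt (real (out_degree (with_proj \<Gamma>) (vs ! i))))"

definition normalized_laplacian :: "'a pair_pre_digraph \<Rightarrow> 'a list \<Rightarrow> real mat" where
  "normalized_laplacian \<Gamma> vs =
     1\<^sub>m (length vs) -
     inv_sqrt_degree_matrix \<Gamma> vs * adjacency_matrix \<Gamma> vs * inv_sqrt_degree_matrix \<Gamma> vs"

end

theory Submission
  imports Defs
begin

text \<open>
  Zero and the \<open>\<phi>(n)\<close> generators of \<open>\<int>\<^sub>n\<close> are adjacent to all other vertices of the power graph.
  If \<open>u\<close> and \<open>v\<close> are two such vertices, the rows of the characteristic matrix \<open>X I - L\<close>
  belonging to them differ by \<open>(X - n / (n - 1)) (e\<^sub>u - e\<^sub>v)\<close>. Subtracting the row of zero from the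
  rows of the generators does not change the determinant, and then \<open>\<phi>(n)\<close> rows are divisible by
  \<open>X - n / (n - 1)\<close>.
\<close>

text \<open>Each product in the Leibniz expansion takes one entry from every row, so the rows in
  \<open>S\<close> contribute \<open>card S\<close> factors divisible by \<open>p\<close>.\<close>

lemma dvd_power_card_det:
  fixes p :: "'a :: comm_ring_1"
  assumes A: "A \<in> carrier_mat n n" and S: "S \<subseteq> {..<n}"
    and dvd: "\<And>i j. i \<in> S \<Longrightarrow> j < n \<Longrightarrow> p dvd A $$ (i, j)"
  shows "p ^ card S dvd det A"
proof -
  have S0: "S \<subseteq> {0..<n}"
    using S by auto
  have "p ^ card S dvd (\<Prod>i = 0..<n. A $$ (i, f i))" if "f permutes {0..<n}" for f
  proof -
    have "p ^ card S = (\<Prod>i\<in>S. p)"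
      by simp
    also have "\<dots> dvd (\<Prod>i\<in>S. A $$ (i, f i))"
    proof (rule prod_dvd_prod)
      fix i assume i: "i \<in> S"
      with S0 permutes_in_image[OF that, of i] have "f i < n"
        by auto
      with i show "p dvd A $$ (i, f i)"
        by (rule dvd)
    qed
    also have "\<dots> dvd (\<Prod>i = 0..<n. A $$ (i, f i))"
      by (rule prod_dvd_prod_subset) (use S0 in auto)
    finally show ?thesis .
  qed
  then show ?thesis
    unfolding det_def'[OF A] by (intro dvd_sum dvd_mult) auto
qed

text \<open>Performed one row at a time, this is a chain of elementary row operations. As
  \<open>i0\<close> is outside \<open>S\<close>, the subtracted row is never altered along the
  way.\<close>

lemma det_subtract_row:
  fixes A :: "'a :: comm_ring_1 mat"
  assumes A: "A \<in> carrier_mat n n" and "finite S" and "i0 < n" and "i0 \<notin> S"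
  shows "det (mat n n (\<lambda>(i, j). if i \<in> S then A $$ (i, j) - A $$ (i0, j) else A $$ (i, j))) = det A"
  using assms(2,4)
proof (induction S rule: finite_induct)
  case empty
  have "mat n n (\<lambda>(i, j). if i \<in> {} then A $$ (i, j) - A $$ (i0, j) else A $$ (i, j)) = A"
    by (rule eq_matI) (use A in auto)
  then show ?case
    by simp
next
  case (insert s S)
  define B where
    "B T = mat n n (\<lambda>(i, j). if i \<in> T then A $$ (i, j) - A $$ (i0, j) else A $$ (i, j))" for T
  have "B (insert s S) = addrow (- 1) s i0 (B S)"
    by (rule eq_matI) (use insert \<open>i0 < n\<close> in \<open>auto simp: B_def\<close>)
  moreover have "det (addrow (- 1) s i0 (B S)) = det (B S)"
    by (rule det_addrow[of _ n]) (use insert \<open>i0 < n\<close> in \<open>auto simp: B_def\<close>)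
  ultimately show ?case
    using insert unfolding B_def by simp
qed

lemma dvd_power_card_det_diff:
  fixes p :: "'a :: comm_ring_1"
  assumes A: "A \<in> carrier_mat n n" and S: "S \<subseteq> {..<n}" and i0: "i0 < n" "i0 \<notin> S"
    and dvd: "\<And>i j. i \<in> S \<Longrightarrow> j < n \<Longrightarrow> p dvd A $$ (i, j) - A $$ (i0, j)"
  shows "p ^ card S dvd det A"
proof -
  have "p ^ card S dvd
      det (mat n n (\<lambda>(i, j). if i \<in> S then A $$ (i, j) - A $$ (i0, j) else A $$ (i, j)))"
    by (rule dvd_power_card_det[of _ n]) (use S dvd in auto)
  also have "\<dots> = det A"
    by (rule det_subtract_row) (use A S i0 in \<open>auto intro: finite_subset\<close>)
  finally show ?thesis .
qed

text \<open>The only property of zero and the generators that the determinant argument uses; that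
  argument can thus be given for arbitrary graphs, apart from the group theory.\<close>

definition dominating_vertex :: "'a pair_pre_digraph \<Rightarrow> 'a \<Rightarrow> bool" where
  "dominating_vertex \<Gamma> v \<longleftrightarrow>
     v \<in> pverts \<Gamma> \<and> (\<forall>w \<in> pverts \<Gamma>. w \<noteq> v \<longrightarrow> (v, w) \<in> parcs \<Gamma>)"

lemma (in pair_graph) dominating_vertex_arc_iff:
  assumes "dominating_vertex G v" "w \<in> pverts G"
  shows "(v, w) \<in> parcs G \<longleftrightarrow> w \<noteq> v"
  using assms pair_no_loops[of "(v, w)"] by (auto simp: dominating_vertex_def)

lemma (in pair_graph) out_degree_dominating_vertex:
  assumes "dominating_vertex G v"
  shows "out_degree (with_proj G) v = card (pverts G) - 1"
proof -
  have "out_arcs (with_proj G) v = Pair v ` (pverts G - {v})"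
    using dominating_vertex_arc_iff[OF assms] arc_snd_in_verts
    by (fastforce simp: out_arcs_def)
  then show ?thesis
    using assms pair_finite_verts
    by (simp add: out_degree_def card_image inj_on_def dominating_vertex_def)
qed

lemma normalized_laplacian_carrier [simp]:
  "normalized_laplacian \<Gamma> vs \<in> carrier_mat (length vs) (length vs)"
  unfolding normalized_laplacian_def inv_sqrt_degree_matrix_def adjacency_matrix_def
  by (intro minus_carrier_mat mult_carrier_mat) auto

lemma normalized_laplacian_index:
  assumes "i < length vs" "j < length vs"
  shows "normalized_laplacian \<Gamma> vs $$ (i, j) =
    (if i = j then 1 else 0) -
    (if (vs ! i, vs ! j) \<in> parcs \<Gamma>
     then 1 / sqrt (real (out_degree (with_proj \<Gamma>) (vs ! i)))
        * (1 / sqrt (real (out_degree (with_proj \<Gamma>) (vs ! j)))) else 0)"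
proof -
  let ?k = "length vs"
  have adj: "adjacency_matrix \<Gamma> vs \<in> carrier_mat ?k ?k"
    by (simp add: adjacency_matrix_def)
  show ?thesis
    unfolding normalized_laplacian_def inv_sqrt_degree_matrix_def mat_diag_mult_left[OF adj]
    by (subst mat_diag_mult_right[of _ ?k ?k])
      (use assms in \<open>auto simp: adjacency_matrix_def\<close>)
qed

text \<open>The vertex \<open>v0\<close> supplies the row to subtract and so has to stay outside
  \<open>S\<close>: with m dominating vertices in all, the method yields the exponent m - 1.\<close>

lemma (in pair_graph) dominating_vertices_dvd_char_poly:
  assumes vs: "distinct vs" "set vs = pverts G" and card: "card (pverts G) \<ge> 2"
    and S: "\<And>v. v \<in> S \<Longrightarrow> dominating_vertex G v"
    and v0: "dominating_vertex G v0" "v0 \<notin> S"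
  defines "\<mu> \<equiv> real (card (pverts G)) / (real (card (pverts G)) - 1)"
  shows "[:- \<mu>, 1:] ^ card S dvd char_poly (normalized_laplacian G vs)"
proof -
  define k where "k = length vs"
  define L where "L = normalized_laplacian G vs"
  define I where "I = {i. i < k \<and> vs ! i \<in> S}"
  have k: "k = card (pverts G)"
    using vs distinct_card k_def by metis
  have L: "L \<in> carrier_mat k k"
    by (simp add: L_def k_def)
  obtain i0 where i0: "i0 < k" "vs ! i0 = v0"
    using v0(1) vs(2) by (metis dominating_vertex_def in_set_conv_nth k_def)
  \<comment> \<open>The determinant lemmas count row indices, whereas \<open>S\<close> consists of
    vertices. The enumeration matches the two.\<close>
  have "bij_betw ((!) vs) I S"
  proof -
    have "S \<subseteq> set vs"
      using S vs(2) by (auto simp: dominating_vertex_def)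
    then show ?thesis
      using vs(1) by (fastforce simp: bij_betw_def inj_on_def I_def k_def in_set_conv_nth nth_eq_iff_index_eq)
  qed
  then have card_I: "card I = card S"
    by (rule bij_betw_same_card)
  define r where "r v = 1 / sqrt (real (out_degree (with_proj G) v))" for v
  have row: "L $$ (i, j) =
      (if i = j then 1 else - r (vs ! i) * r (vs ! j))"
    if "i < k" "j < k" "dominating_vertex G (vs ! i)" for i j
  proof -
    have "vs ! j \<in> pverts G"
      using that vs nth_mem by (metis k_def)
    from dominating_vertex_arc_iff[OF that(3) this]
    have "(vs ! i, vs ! j) \<in> parcs G \<longleftrightarrow> i \<noteq> j"
      using that vs by (auto simp: k_def nth_eq_iff_index_eq)
    then show ?thesis
      using that by (auto simp: L_def k_def r_def normalized_laplacian_index)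
  qed
  define c where "c = 1 / sqrt (real k - 1)"
  have r: "r v = c" if "dominating_vertex G v" for v
    using out_degree_dominating_vertex[OF that] card k by (simp add: r_def c_def of_nat_diff)
  \<comment> \<open>Dominating vertices have degree k - 1, so this is 1 + 1 / (k - 1) = k / (k -
    1).\<close>
  have cc: "1 + c * c = \<mu>"
    using card k by (simp add: c_def \<mu>_def field_simps)
  have "[:- \<mu>, 1:] ^ card I dvd det (char_poly_matrix L)"
  proof (rule dvd_power_card_det_diff[of _ k])
    show "char_poly_matrix L \<in> carrier_mat k k"
      using L by simp
    show "I \<subseteq> {..<k}" "i0 < k" "i0 \<notin> I"
      using i0 v0 by (auto simp: I_def)
    fix i j assume i: "i \<in> I" and j: "j < k"
    have i': "i < k" "dominating_vertex G (vs ! i)" "i \<noteq> i0"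
      using i S i0 v0 by (auto simp: I_def)
    have dom0: "dominating_vertex G (vs ! i0)"
      using i0 v0 by simp
    have entry: "char_poly_matrix L $$ (l, j) = (if l = j then [:0, 1:] else 0) + [:- L $$ (l, j):]"
      if "l < k" for l
      using that j L by (auto simp: char_poly_matrix_def)
    \<comment> \<open>In column \<open>i\<close> the difference is (X - 1) - c * c, in column
      \<open>i0\<close> its negative. In any other column both entries are c * r (vs ! j) and
      cancel.\<close>
    have "char_poly_matrix L $$ (i, j) - char_poly_matrix L $$ (i0, j) =
        [:- \<mu>, 1:] * (if j = i then 1 else if j = i0 then - 1 else 0)"
      using i' i0 j dom0 by (auto simp: entry row r cc[symmetric])
    then show "[:- \<mu>, 1:] dvd char_poly_matrix L $$ (i, j) - char_poly_matrix L $$ (i0, j)"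
      by (metis dvd_triv_left)
  qed
  then show ?thesis
    by (simp add: char_poly_def L_def card_I)
qed

lemma dominating_vertex_power_graphI:
  assumes "x \<in> carrier G"
    and "\<And>y. y \<in> carrier G \<Longrightarrow> \<exists>i::nat. i > 0 \<and> (y = x [^]\<^bsub>G\<^esub> i \<or> x = y [^]\<^bsub>G\<^esub> i)"
  shows "dominating_vertex (power_graph G) x"
  using assms by (auto simp: dominating_vertex_def power_graph_def)

text \<open>Zero is a positive power of every element \<open>y\<close>, since n y = 0 in the
  group.\<close>

lemma dominating_vertex_zero:
  assumes "n > 0"
  shows "dominating_vertex (power_graph (integer_mod_group n)) 0"
  by (rule dominating_vertex_power_graphI) (use assms in \<open>auto intro: exI[of _ n]\<close>)

text \<open>If \<open>z\<close> inverts \<open>x\<close> modulo \<open>n\<close>, then y = (y z) x,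
  so every \<open>y\<close> is a multiple of \<open>x\<close>.\<close>

lemma dominating_vertex_generator:
  assumes "n > 0" "x \<in> carrier (integer_mod_group n)" "coprime x (int n)"
  shows "dominating_vertex (power_graph (integer_mod_group n)) x"
proof (rule dominating_vertex_power_graphI)
  fix y assume y: "y \<in> carrier (integer_mod_group n)"
  obtain z where z: "[x * z = 1] (mod int n)"
    using cong_solve_coprime_int[OF assms(3)] by blast
  \<comment> \<open>Adding \<open>n\<close> keeps the exponent positive when y z is 0 modulo
    \<open>n\<close>, and does not change the resulting multiple of \<open>x\<close>.\<close>
  define i where "i = nat ((y * z) mod int n) + n"
  have "int i * x = (y * z) mod int n * x + int n * x"
    using assms(1) by (simp add: i_def algebra_simps)
  then have "[int i * x = y * (x * z)] (mod int n)"
    by (simp add: cong_def mod_simps mult_ac)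
  also have "[y * (x * z) = y * 1] (mod int n)"
    using z by (rule cong_scalar_left)
  finally have "y = x [^]\<^bsub>integer_mod_group n\<^esub> i"
    using y assms(1) by (simp add: cong_def carrier_integer_mod_group)
  moreover have "i > 0"
    using assms(1) by (simp add: i_def)
  ultimately show "\<exists>i::nat. i > 0 \<and>
      (y = x [^]\<^bsub>integer_mod_group n\<^esub> i \<or> x = y [^]\<^bsub>integer_mod_group n\<^esub> i)"
    by blast
qed (use assms in simp)

theorem theorem4p4:
  fixes n :: nat and vs :: "int list"
  assumes "n \<ge> 3"
    and "distinct vs"
    and "set vs = pverts (power_graph (integer_mod_group n))"
  shows "eigenvalue (normalized_laplacian (power_graph (integer_mod_group n)) vs)
           (real n / (real n - 1)) \<and>
         Polynomial.order (real n / (real n - 1))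
           (char_poly (normalized_laplacian (power_graph (integer_mod_group n)) vs)) \<ge> totient n"
proof -
  let ?G = "power_graph (integer_mod_group n)"
  define L where "L = normalized_laplacian ?G vs"
  have carrier: "carrier (integer_mod_group n) = {0..<int n}"
    using assms(1) by (simp add: carrier_integer_mod_group)
  interpret pair_graph ?G
    by (rule pair_graph_power_graph) (simp add: carrier)
  have card: "card (pverts ?G) = n"
    by (simp add: power_graph_def carrier)
  \<comment> \<open>Totatives are positive, which leaves zero free to play the part of
    \<open>v0\<close>. As n > 1, they are also less than \<open>n\<close> and hence elements of the
    group.\<close>
  have "[:- (real n / (real n - 1)), 1:] ^ card (int ` totatives n) dvd char_poly L"
    unfolding L_def
  proof (rule dominating_vertices_dvd_char_poly[of vs "int ` totatives n" 0, unfolded card])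
    show "dominating_vertex ?G 0"
      using assms(1) by (intro dominating_vertex_zero) simp
    show "dominating_vertex ?G v" if "v \<in> int ` totatives n" for v
      using that assms(1) totatives_less[of _ n]
      by (intro dominating_vertex_generator) (auto simp: carrier in_totatives_iff)
  qed (use assms in auto)
  moreover have "card (int ` totatives n) = totient n"
    by (simp add: card_image totient_def)
  moreover have L: "L \<in> carrier_mat (length vs) (length vs)"
    by (simp add: L_def)
  \<comment> \<open>Divisibility by a power bounds the order of a root only for a nonzero
    polynomial; this one is monic.\<close>
  moreover have nz: "char_poly L \<noteq> 0"
    using degree_monic_char_poly[OF L] by auto
  ultimately have ord: "totient n \<le> Polynomial.order (real n / (real n - 1)) (char_poly L)"
    by (simp add: order_divides)
  \<comment> \<open>A positive order makes the value a root, hence an eigenvalue.\<close>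
  moreover have "totient n > 0"
    using assms(1) by simp
  ultimately have "poly (char_poly L) (real n / (real n - 1)) = 0"
    unfolding order_root by linarith
  then have "eigenvalue L (real n / (real n - 1))"
    using eigenvalue_root_char_poly[OF L] by simp
  with ord show ?thesis
    by (simp add: L_def)
qed

end
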